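(* Let $f\colon\mathcal X\setminus\mathcal O\to(0,\infty)$. A function $u\colon\mathcal X\to\mathbb R$ satisfies $$u(x)=F[u](x),\qquad x\in\mathcal X\setminus\mathcal O,$$ if and only if it is strictly graph convex on $\mathcal X\setminus\mathcal O$ and satisfies $$\mathcal M[u](x)=f(x),\qquad x\in\mathcal X\setminus\mathcal O.$$
   Context: $\mathcal G=(\mathcal X,E)$ is a finite simple undirected graph, $\mathcal O\subseteq\mathcal X$ is the set of boundary vertices, and $\mathcal N_x$ is the set of neighbors of $x$. There is a fixed even integer $n\ge2$ with $|\mathcal N_x|=n$ for every $x\in\mathcal X\setminus\mathcal O$ (no degree condition on vertices of $\mathcal O$). For $u\colon\mathcal X\to\mathbb R$, $x\in\mathcal X\setminus\mathcal O$ and $i\in\{1,\dots,n/2\}$, define $$H_i[u](x)=\min_{\substack{S\subseteq\mathcal N_x\\ |S|=2i}}\ \max_{\substack{y,z\in S\\ y\ne z}}\frac{u(y)+u(z)}2,\qquad \lambda_i[u](x)=H_i[u](x)-u(x),\qquad \mathcal M[u](x)=\prod_{i=1}^{n/2}\lambda_i[u](x).$$ Let $\mathcal A_k=\{\alpha\in(0,\infty)^k:\prod_{i=1}^k\alpha_i=1\}$. Given $f$, for $x\in\mathcal X\setminus\mathcal O$ and $\alpha\in\mathcal A_{n/2}$ define $$\mathcal Q_u(x;\alpha)=\frac{\sum_{i=1}^{n/2}\alpha_iH_i[u](x)-\frac n2f(x)^{2/n}}{\sum_{i=1}^{n/2}\alpha_i},\qquad F[u](x)=\inf_{\alpha\in\mathcal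 A_{n/2}}\mathcal Q_u(x;\alpha).$$ A function $u$ is strictly graph convex on $A\subseteq\mathcal X$ if $\frac{u(y)+u(z)}2>u(x)$ for every $x\in A$ and every pair of distinct $y,z\in\mathcal N_x$. *)

theory Defs
  imports "HOL-Analysis.Analysis" "Graph_Theory.Pair_Digraph"
begin

text \<open>
  A finite simple undirected graph is a \<open>pair_graph\<close>: a finite, loop-free, symmetric relation
  on a finite vertex set.  Functions on vertices are total functions on the ambient type; only
  their values on vertices matter.
\<close>

definition nbhd :: "'a pair_pre_digraph \<Rightarrow> 'a \<Rightarrow> 'a set" where
  "nbhd G x = {y. x \<rightarrow>\<^bsub>with_proj G\<^esub> y}"

text \<open>
  For a vertex \<open>x\<close> of a finite graph with at least \<open>2 * i\<close> neighbours and \<open>i \<ge> 1\<close>, both the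
  minimum and the maximum below are taken over finite nonempty sets of reals.
\<close>

definition H_op :: "'a pair_pre_digraph \<Rightarrow> nat \<Rightarrow> ('a \<Rightarrow> real) \<Rightarrow> 'a \<Rightarrow> real" where
  "H_op G i u x =
     (MIN S\<in>{S. S \<subseteq> nbhd G x \<and> card S = 2 * i}.
        Max {(u y + u z) / 2 | y z. y \<in> S \<and> z \<in> S \<and> y \<noteq> z})"

definition lambda_op :: "'a pair_pre_digraph \<Rightarrow> nat \<Rightarrow> ('a \<Rightarrow> real) \<Rightarrow> 'a \<Rightarrow> real" where
  "lambda_op G i u x = H_op G i u x - u x"

definition MA_op :: "'a pair_pre_digraph \<Rightarrow> nat \<Rightarrow> ('a \<Rightarrow> real) \<Rightarrow> 'a \<Rightarrow> real" where
  "MA_op G n u x = (\<Prod>i=1..n div 2. lambda_op G i u x)"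

text \<open>
  A point of \<open>(0,\<infinity>)\<^sup>k\<close> is an extensional function on \<open>{1..k}\<close> with positive values.
\<close>

definition weights :: "nat \<Rightarrow> (nat \<Rightarrow> real) set" where
  "weights k = {\<alpha> \<in> {1..k} \<rightarrow>\<^sub>E {0<..}. (\<Prod>i=1..k. \<alpha> i) = 1}"

definition Q_op ::
  "'a pair_pre_digraph \<Rightarrow> nat \<Rightarrow> ('a \<Rightarrow> real) \<Rightarrow> ('a \<Rightarrow> real) \<Rightarrow> 'a \<Rightarrow> (nat \<Rightarrow> real) \<Rightarrow> real" where
  "Q_op G n f u x \<alpha> =
     ((\<Sum>i=1..n div 2. \<alpha> i * H_op G i u x) - real n / 2 * f x powr (2 / real n))
       / (\<Sum>i=1..n div 2. \<alpha> i)"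

text \<open>
  The infimum is a real infimum.  For even \<open>n \<ge> 2\<close> the set is nonempty (take all weights
  equal to \<open>1\<close>), and it is bounded below because the sum of the weights is at least \<open>n / 2\<close> by
  the inequality between arithmetic and geometric means.
\<close>

definition F_op ::
  "'a pair_pre_digraph \<Rightarrow> nat \<Rightarrow> ('a \<Rightarrow> real) \<Rightarrow> ('a \<Rightarrow> real) \<Rightarrow> 'a \<Rightarrow> real" where
  "F_op G n f u x = (INF \<alpha>\<in>weights (n div 2). Q_op G n f u x \<alpha>)"

definition strictly_graph_convex_on ::
  "'a pair_pre_digraph \<Rightarrow> 'a set \<Rightarrow> ('a \<Rightarrow> real) \<Rightarrow> bool" where
  "strictly_graph_convex_on G A u \<longleftrightarrow>
     (\<forall>x\<in>A. \<forall>y\<in>nbhd G x. \<forall>z\<in>nbhd G x. y \<noteq> z \<longrightarrow> (u y + u z) / 2 > u x)"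

end

theory Submission
  imports Defs
begin

text \<open>
  Fix a vertex and write \<open>k = n / 2\<close>, \<open>h\<^sub>i = H\<^sub>i[u](x)\<close> and \<open>c = f(x)\<^bsup>1/k\<^esup>\<close>.  The infimum defining
  \<open>F[u](x)\<close> depends on \<open>h\<close> and \<open>c\<close> only.  If \<open>v\<close> lies below all \<open>h\<^sub>i\<close> and
  \<open>\<Prod>(h\<^sub>i - v) = c\<^sup>k\<close>, then the inequality between arithmetic and geometric means gives
  \<open>\<Sum>\<alpha>\<^sub>i (h\<^sub>i - v) \<ge> k c\<close> for all weights, with equality at \<open>\<alpha>\<^sub>i = c / (h\<^sub>i - v)\<close>; hence the infimum
  is \<open>v\<close>.  Such a \<open>v\<close> exists by the intermediate value theorem, so the infimum is always a root of
  the product equation below all \<open>h\<^sub>i\<close>, which gives the converse as well.  Strict graph convexity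
  at \<open>x\<close> is the condition that \<open>u(x)\<close> lies below all \<open>h\<^sub>i\<close>, because \<open>H\<^sub>1\<close> is the minimum of
  \<open>(u(y) + u(z)) / 2\<close> over pairs of distinct neighbours and every \<open>H\<^sub>i\<close> is one of these averages.
\<close>

lemma sum_ge_of_prod_eq_power:
  fixes x :: "nat \<Rightarrow> real"
  assumes "1 \<le> k" "0 \<le> c" "\<And>i. i \<in> {1..k} \<Longrightarrow> 0 \<le> x i" "(\<Prod>i=1..k. x i) = c ^ k"
  shows "real k * c \<le> (\<Sum>i=1..k. x i)"
proof -
  \<comment> \<open>This identifies the geometric mean of the \<open>x i\<close> as
    \<open>c\<close>.\<close>
  have "(c ^ k) powr (1 / real k) = c"
    using assms(1,2) real_root_power_cancel[of k c]
    by (simp add: root_powr_inverse[symmetric])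
  then have "c \<le> (\<Sum>i=1..k. x i) / real k"
    using arith_geom_mean[of "{1..k}" x] assms by (simp add: sum_divide_distrib)
  then show ?thesis
    using assms(1) by (simp add: field_simps)
qed

lemma INF_weights_eq:
  fixes h :: "nat \<Rightarrow> real"
  assumes k: "1 \<le> k" and c: "0 < c"
    and lt: "\<And>i. i \<in> {1..k} \<Longrightarrow> v < h i"
    and prod: "(\<Prod>i=1..k. h i - v) = c ^ k"
  shows "(INF \<alpha>\<in>weights k. ((\<Sum>i=1..k. \<alpha> i * h i) - real k * c) / (\<Sum>i=1..k. \<alpha> i)) = v"
proof (rule cInf_eq_minimum)
  \<comment> \<open>Measured from \<open>v\<close>, the quotient exceeds \<open>v\<close> by a
    multiple of \<open>(\<Sum>i=1..k. \<alpha> i * (h i - v)) - k * c\<close>, whose sign AM-GM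
    controls.\<close>
  have split: "(\<Sum>i=1..k. \<alpha> i * h i) = (\<Sum>i=1..k. \<alpha> i * (h i - v)) + v * (\<Sum>i=1..k. \<alpha> i)" for \<alpha>
    by (simp add: algebra_simps sum.distrib sum_subtractf sum_distrib_left)
  have spos: "0 < (\<Sum>i=1..k. \<alpha> i)" if "\<alpha> \<in> weights k" for \<alpha>
    using that k by (intro sum_pos) (auto simp: weights_def)
  \<comment> \<open>The restriction supplies the extensionality that \<open>weights\<close>
    demands.\<close>
  define \<beta> where "\<beta> = (\<lambda>i\<in>{1..k}. c / (h i - v))"
  have \<beta>: "\<beta> \<in> weights k"
  proof -
    have "(\<Prod>i=1..k. \<beta> i) = (\<Prod>i=1..k. c / (h i - v))"
      by (rule prod.cong) (auto simp: \<beta>_def)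
    also have "\<dots> = c ^ k / (\<Prod>i=1..k. h i - v)"
      by (simp add: prod_dividef)
    finally have "(\<Prod>i=1..k. \<beta> i) = 1"
      using c prod by simp
    then show ?thesis
      using c lt by (auto simp: weights_def \<beta>_def)
  qed
  have "(\<Sum>i=1..k. \<beta> i * (h i - v)) = (\<Sum>i=1..k. c)"
    using lt by (intro sum.cong) (force simp: \<beta>_def)+
  then have "((\<Sum>i=1..k. \<beta> i * h i) - real k * c) / (\<Sum>i=1..k. \<beta> i) = v"
    unfolding split using spos[OF \<beta>] by simp
  then show "v \<in> (\<lambda>\<alpha>. ((\<Sum>i=1..k. \<alpha> i * h i) - real k * c) / (\<Sum>i=1..k. \<alpha> i)) ` weights k"
    using \<beta> by (metis (no_types, lifting) imageI)
  fix q
  assume "q \<in> (\<lambda>\<alpha>. ((\<Sum>i=1..k. \<alpha> i * h i) - real k * c) / (\<Sum>i=1..k. \<alpha> i)) ` weights k"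
  then obtain \<alpha> where \<alpha>: "\<alpha> \<in> weights k"
    and q: "q = ((\<Sum>i=1..k. \<alpha> i * h i) - real k * c) / (\<Sum>i=1..k. \<alpha> i)"
    by blast
  have "real k * c \<le> (\<Sum>i=1..k. \<alpha> i * (h i - v))"
  proof (rule sum_ge_of_prod_eq_power)
    show "0 \<le> \<alpha> i * (h i - v)" if "i \<in> {1..k}" for i
      using \<alpha> lt[OF that] that by (intro mult_nonneg_nonneg) (auto simp: weights_def PiE_iff less_imp_le)
    show "(\<Prod>i=1..k. \<alpha> i * (h i - v)) = c ^ k"
      using \<alpha> prod by (simp add: weights_def prod.distrib)
  qed (use k c in auto)
  then show "v \<le> q"
    unfolding q split using spos[OF \<alpha>] by (simp add: pos_le_divide_eq)
qed

text \<open>The product vanishes at the least \<open>h i\<close> and is at least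
  \<open>c ^ k\<close> at distance \<open>c\<close> below it, so it takes the value
  \<open>c ^ k\<close> in between.\<close>

lemma ex_prod_diff_eq:
  fixes h :: "nat \<Rightarrow> real"
  assumes k: "1 \<le> k" and c: "0 < c"
  obtains v where "\<And>i. i \<in> {1..k} \<Longrightarrow> v < h i" "(\<Prod>i=1..k. h i - v) = c ^ k"
proof -
  define m where "m = Min (h ` {1..k})"
  have m_le: "m \<le> h i" if "i \<in> {1..k}" for i
    unfolding m_def using that by (intro Min_le) auto
  have "m \<in> h ` {1..k}"
    unfolding m_def using k by (intro Min_in) auto
  then have "(\<Prod>i=1..k. h i - m) = 0"
    by (auto intro!: prod_zero)
  then have "(\<Prod>i=1..k. h i - m) \<le> c ^ k"
    using zero_less_power[OF c, of k] by linarith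
  moreover have "c ^ k \<le> (\<Prod>i=1..k. h i - (m - c))"
  proof -
    have "(\<Prod>i=1..k. c) \<le> (\<Prod>i=1..k. h i - (m - c))"
      using c m_le by (intro prod_mono) force
    then show ?thesis by simp
  qed
  ultimately have "\<exists>v\<ge>m - c. v \<le> m \<and> (\<Prod>i=1..k. h i - v) = c ^ k"
    using c by (intro IVT2') (auto intro!: continuous_intros)
  then obtain v where v: "v \<le> m" "(\<Prod>i=1..k. h i - v) = c ^ k"
    by blast
  \<comment> \<open>The closed interval allows \<open>v = m\<close>, but then a factor would vanish,
    against \<open>c ^ k > 0\<close>.\<close>
  have "v < h i" if "i \<in> {1..k}" for i
  proof -
    have "h i - v \<noteq> 0"
      using v(2) c that by (metis finite_atLeastAtMost less_irrefl prod_zero_iff zero_less_power)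
    then show ?thesis
      using v(1) m_le[OF that] by simp
  qed
  with v(2) that show thesis by blast
qed

text \<open>Every root below all \<open>h i\<close> equals the infimum; since such a root exists,
  the infimum is itself that root.\<close>

lemma eq_INF_weights_iff:
  fixes h :: "nat \<Rightarrow> real"
  assumes "1 \<le> k" "0 < c"
  shows "v = (INF \<alpha>\<in>weights k. ((\<Sum>i=1..k. \<alpha> i * h i) - real k * c) / (\<Sum>i=1..k. \<alpha> i)) \<longleftrightarrow>
    (\<forall>i\<in>{1..k}. v < h i) \<and> (\<Prod>i=1..k. h i - v) = c ^ k"
proof -
  obtain w where w: "\<And>i. i \<in> {1..k} \<Longrightarrow> w < h i" "(\<Prod>i=1..k. h i - w) = c ^ k"
    using ex_prod_diff_eq[OF assms] by blast
  show ?thesis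
    using INF_weights_eq[OF assms w] w INF_weights_eq[OF assms, of v h] by auto
qed

text \<open>Minimum and maximum run over finite nonempty families, so both are attained.\<close>

lemma H_op_in_averages:
  assumes "finite (nbhd G x)" "1 \<le> i" "2 * i \<le> card (nbhd G x)"
  obtains y z where "y \<in> nbhd G x" "z \<in> nbhd G x" "y \<noteq> z" "H_op G i u x = (u y + u z) / 2"
proof -
  define A where "A S = {(u y + u z) / 2 | y z. y \<in> S \<and> z \<in> S \<and> y \<noteq> z}" for S
  define \<S> where "\<S> = {S. S \<subseteq> nbhd G x \<and> card S = 2 * i}"
  have "finite \<S>"
    unfolding \<S>_def using assms(1) by simp
  moreover have "\<S> \<noteq> {}"
    unfolding \<S>_def using obtain_subset_with_card_n[OF assms(3)] by blast
  ultimately have "(MIN S\<in>\<S>. Max (A S)) \<in> (\<lambda>S. Max (A S)) ` \<S>"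
    by (intro Min_in) auto
  then obtain S where S: "S \<subseteq> nbhd G x" "card S = 2 * i" and H: "H_op G i u x = Max (A S)"
    unfolding H_op_def A_def \<S>_def by blast
  have "finite S"
    using S(1) assms(1) finite_subset by blast
  then have "finite ((\<lambda>(y, z). (u y + u z) / 2) ` (S \<times> S))"
    by simp
  then have "finite (A S)"
    by (rule rev_finite_subset) (force simp: A_def)
  moreover have "A S \<noteq> {}"
  proof -
    \<comment> \<open>As \<open>2 * i \<ge> 2\<close>, the set \<open>S\<close> contains a pair of
      distinct elements.\<close>
    have "\<not> card S \<le> Suc 0"
      using S(2) assms(2) by linarith
    then obtain y z where "y \<in> S" "z \<in> S" "y \<noteq> z"
      using \<open>finite S\<close> by (auto simp: card_le_Suc0_iff_eq)
    then show ?thesis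
      unfolding A_def by blast
  qed
  ultimately have "Max (A S) \<in> A S"
    by (rule Max_in)
  then obtain y z where "y \<in> S" "z \<in> S" "y \<noteq> z" "Max (A S) = (u y + u z) / 2"
    unfolding A_def by blast
  then show thesis
    using that[of y z] S(1) H by auto
qed

text \<open>The set \<open>{y, z}\<close> itself competes in the minimum.\<close>

lemma H_op_1_le:
  assumes "finite (nbhd G x)" "y \<in> nbhd G x" "z \<in> nbhd G x" "y \<noteq> z"
  shows "H_op G 1 u x \<le> (u y + u z) / 2"
proof -
  have "H_op G 1 u x \<le> Max {(u a + u b) / 2 | a b. a \<in> {y, z} \<and> b \<in> {y, z} \<and> a \<noteq> b}"
    unfolding H_op_def
  proof (rule Min_le)
    have "{y, z} \<in> {S. S \<subseteq> nbhd G x \<and> card S = 2 * 1}"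
      using assms by simp
    then show "Max {(u a + u b) / 2 | a b. a \<in> {y, z} \<and> b \<in> {y, z} \<and> a \<noteq> b} \<in>
      (\<lambda>S. Max {(u a + u b) / 2 | a b. a \<in> S \<and> b \<in> S \<and> a \<noteq> b}) `
        {S. S \<subseteq> nbhd G x \<and> card S = 2 * 1}"
      by (rule rev_image_eqI) (rule refl)
  qed (use assms(1) in simp)
  \<comment> \<open>Both orderings of the pair give the same average.\<close>
  also have "{(u a + u b) / 2 | a b. a \<in> {y, z} \<and> b \<in> {y, z} \<and> a \<noteq> b} = {(u y + u z) / 2}"
    using assms(4) by (fastforce simp: add.commute)
  finally show ?thesis by simp
qed

lemma less_H_op_iff:
  assumes "finite (nbhd G x)" "1 \<le> k" "2 * k \<le> card (nbhd G x)"
  shows "(\<forall>i\<in>{1..k}. u x < H_op G i u x) \<longleftrightarrow>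
    (\<forall>y\<in>nbhd G x. \<forall>z\<in>nbhd G x. y \<noteq> z \<longrightarrow> (u y + u z) / 2 > u x)"
proof
  assume "\<forall>i\<in>{1..k}. u x < H_op G i u x"
  then have "u x < H_op G 1 u x"
    using assms(2) by auto
  then show "\<forall>y\<in>nbhd G x. \<forall>z\<in>nbhd G x. y \<noteq> z \<longrightarrow> (u y + u z) / 2 > u x"
    using H_op_1_le[OF assms(1)] less_le_trans by blast
next
  assume conv: "\<forall>y\<in>nbhd G x. \<forall>z\<in>nbhd G x. y \<noteq> z \<longrightarrow> (u y + u z) / 2 > u x"
  show "\<forall>i\<in>{1..k}. u x < H_op G i u x"
  proof
    fix i
    assume "i \<in> {1..k}"
    then obtain y z where "y \<in> nbhd G x" "z \<in> nbhd G x" "y \<noteq> z" "H_op G i u x = (u y + u z) / 2"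
      using H_op_in_averages[OF assms(1), of i u] assms(3) by auto
    then show "u x < H_op G i u x"
      using conv by metis
  qed
qed

theorem theorem3p3:
  fixes G :: "'a pair_pre_digraph" and Bd :: "'a set" and n :: nat
    and f u :: "'a \<Rightarrow> real"
  assumes "pair_graph G"
    and "Bd \<subseteq> pverts G"
    and "even n" and "n \<ge> 2"
    and "\<forall>x \<in> pverts G - Bd. card (nbhd G x) = n"
    and "\<forall>x \<in> pverts G - Bd. f x > 0"
  shows "(\<forall>x \<in> pverts G - Bd. u x = F_op G n f u x) \<longleftrightarrow>
         (strictly_graph_convex_on G (pverts G - Bd) u \<and>
          (\<forall>x \<in> pverts G - Bd. MA_op G n u x = f x))"
proof -
  define k where "k = n div 2"
  have n: "n = 2 * k" and k: "1 \<le> k"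
    using assms(3,4) by (auto simp: k_def)
  have "u x = F_op G n f u x \<longleftrightarrow>
      (\<forall>y\<in>nbhd G x. \<forall>z\<in>nbhd G x. y \<noteq> z \<longrightarrow> (u y + u z) / 2 > u x) \<and> MA_op G n u x = f x"
    if x: "x \<in> pverts G - Bd" for x
  proof -
    have card: "card (nbhd G x) = 2 * k" and fx: "0 < f x"
      using assms(5,6) x n by auto
    \<comment> \<open>Infinite sets have \<open>card\<close> 0, so a positive degree forces
      finiteness.\<close>
    then have fin: "finite (nbhd G x)"
      using k by (intro card_ge_0_finite) simp
    \<comment> \<open>Since \<open>n = 2 * k\<close>, the term
      \<open>n / 2 * f x powr (2 / n)\<close> is \<open>k * c\<close>.\<close>
    define c where "c = f x powr (1 / real k)"
    have c: "0 < c" and ck: "c ^ k = f x"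
      using fx k by (simp_all add: c_def powr_realpow[symmetric] powr_powr)
    have F: "F_op G n f u x =
        (INF \<alpha>\<in>weights k. ((\<Sum>i=1..k. \<alpha> i * H_op G i u x) - real k * c) / (\<Sum>i=1..k. \<alpha> i))"
      using k by (simp add: F_op_def Q_op_def n c_def)
    have "u x = F_op G n f u x \<longleftrightarrow>
        (\<forall>i\<in>{1..k}. u x < H_op G i u x) \<and> (\<Prod>i=1..k. H_op G i u x - u x) = c ^ k"
      unfolding F by (rule eq_INF_weights_iff[OF k c])
    moreover have "MA_op G n u x = (\<Prod>i=1..k. H_op G i u x - u x)"
      by (simp add: MA_op_def lambda_op_def n)
    ultimately show ?thesis
      using less_H_op_iff[OF fin k, of u] card ck by simp
  qed
  then show ?thesis
    unfolding strictly_graph_convex_on_def by (simp add: ball_conj_distrib)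
qed

end
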